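(* If $I$ is a density ideal on $\omega$, then the space $N_{I^*}$ has the bounded Josefson--Nissenzweig property (BJNP).
   Context: For $S\subseteq\wp(\omega)$, $S^*=\{A\subseteq\omega: \omega\setminus A\in S\}$. An ideal on $\omega$ is a family $I$ such that $I^*$ is a proper filter. A submeasure on $\omega$ is $\varphi:\wp(\omega)\to[0,+\infty]$ with $\varphi(\emptyset)=0$, $\varphi(\{n\})<\infty$ for all $n$, and $\varphi(A)\le\varphi(A\cup B)\le\varphi(A)+\varphi(B)$. A density submeasure is a submeasure of the form $\varphi=\sup_{n\in\omega}\mu_n$ for some sequence $\langle\mu_n\rangle$ of finitely supported non-negative measures on $\omega$ with pairwise disjoint supports. An ideal $I$ is a density ideal if $I=\operatorname{Exh}(\varphi)$ for some density submeasure $\varphi$, where $\operatorname{Exh}(\varphi)=\{A\subseteq\omega:\lim_{n\to\infty}\varphi(A\setminus[0,n])=0\}$. For a free filter $F$ on $\omega$ (i.e. one with $\bigcap F=\emptyset$), $N_F=\omega\cup\{p_F\}$, $p_F\notin\omega$, with the topology in which every point of $\omega$ is isolated and the open neighborhoods of $p_F$ are exactly the sets $A\cup\{p_F\}$ with $A\in F$. A finitely supported measure on a Tychonoff space $X$ is $\mu=\sum_{i=1}^n\alpha_i\delta_{x_i}$ with distinct $x_i\in X$ and $\alpha_i\in\mathbb{R}\setminus\{0\}$; $\|\mu\|=\sum_i|\alpha_i|$, $\mu(f)=\sum_i\alpha_i f(x_i)$. $X$ has the BJNP if there is a sequence $\langle\mu_n: n\in\omega\rangle$ of finitely supported measures on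 $X$ with $\|\mu_n\|=1$ for all $n$ and $\mu_n(f)\to0$ for every bounded continuous $f:X\to\mathbb{R}$. *)

theory Defs
  imports "HOL-Analysis.Analysis" "HOL-Library.Poly_Mapping"
begin

section \<open>Filters and ideals as families of sets\<close>

definition dual_family :: "'a set set \<Rightarrow> 'a set set" where
  "dual_family S = {A. - A \<in> S}"

definition proper_filter :: "'a set set \<Rightarrow> bool" where
  "proper_filter F \<longleftrightarrow> is_filter (\<lambda>P. Collect P \<in> F) \<and> {} \<notin> F"

definition free_filter :: "'a set set \<Rightarrow> bool" where
  "free_filter F \<longleftrightarrow> proper_filter F \<and> \<Inter>F = {}"

definition ideal_on_omega :: "nat set set \<Rightarrow> bool" where
  "ideal_on_omega I \<longleftrightarrow> proper_filter (dual_family I)"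

section \<open>Finitely supported signed measures\<close>

text \<open>
  The measure \<open>\<Sum>\<^sub>i \<alpha>\<^sub>i \<delta>\<^bsub>x\<^sub>i\<^esub>\<close> (distinct \<open>x\<^sub>i\<close>, nonzero real \<open>\<alpha>\<^sub>i\<close>) is represented by the
  finitely supported function \<open>x\<^sub>i \<mapsto> \<alpha>\<^sub>i\<close>; its support is the set \<open>Poly_Mapping.keys\<close>.
  The zero measure is allowed.
\<close>

type_synonym 'a fs_measure = "'a \<Rightarrow>\<^sub>0 real"

definition fs_measure_of :: "'a fs_measure \<Rightarrow> 'a set \<Rightarrow> real" where
  "fs_measure_of \<mu> A = (\<Sum>x \<in> Poly_Mapping.keys \<mu> \<inter> A. Poly_Mapping.lookup \<mu> x)"

definition fs_norm :: "'a fs_measure \<Rightarrow> real" where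
  "fs_norm \<mu> = (\<Sum>x \<in> Poly_Mapping.keys \<mu>. \<bar>Poly_Mapping.lookup \<mu> x\<bar>)"

definition fs_integral :: "'a fs_measure \<Rightarrow> ('a \<Rightarrow> real) \<Rightarrow> real" where
  "fs_integral \<mu> f = (\<Sum>x \<in> Poly_Mapping.keys \<mu>. Poly_Mapping.lookup \<mu> x * f x)"

definition fs_nonneg :: "'a fs_measure \<Rightarrow> bool" where
  "fs_nonneg \<mu> \<longleftrightarrow> (\<forall>x. 0 \<le> Poly_Mapping.lookup \<mu> x)"

section \<open>Submeasures and density ideals\<close>

definition submeasure :: "(nat set \<Rightarrow> ennreal) \<Rightarrow> bool" where
  "submeasure \<phi> \<longleftrightarrow>
     \<phi> {} = 0 \<and> (\<forall>n. \<phi> {n} < \<infinity>) \<and>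
     (\<forall>A B. \<phi> A \<le> \<phi> (A \<union> B) \<and> \<phi> (A \<union> B) \<le> \<phi> A + \<phi> B)"

definition density_submeasure :: "(nat set \<Rightarrow> ennreal) \<Rightarrow> bool" where
  "density_submeasure \<phi> \<longleftrightarrow> submeasure \<phi> \<and>
     (\<exists>\<mu> :: nat \<Rightarrow> nat fs_measure.
        (\<forall>n. fs_nonneg (\<mu> n)) \<and>
        disjoint_family (\<lambda>n. Poly_Mapping.keys (\<mu> n)) \<and>
        (\<forall>A. \<phi> A = (SUP n. ennreal (fs_measure_of (\<mu> n) A))))"

definition Exh :: "(nat set \<Rightarrow> ennreal) \<Rightarrow> nat set set" where
  "Exh \<phi> = {A. (\<lambda>n. \<phi> (A - {0..n})) \<longlonglongrightarrow> 0}"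

definition density_ideal :: "nat set set \<Rightarrow> bool" where
  "density_ideal I \<longleftrightarrow> ideal_on_omega I \<and> (\<exists>\<phi>. density_submeasure \<phi> \<and> I = Exh \<phi>)"

section \<open>The space \<open>N\<^sub>F\<close>\<close>

text \<open>
  The point \<open>p\<^sub>F\<close> is \<open>None\<close>, and \<open>n \<in> \<omega>\<close> is \<open>Some n\<close>. The predicate below is a topology
  whenever \<open>F\<close> is a proper filter; for other families \<open>N_space F\<close> is unspecified.
\<close>

definition N_space :: "nat set set \<Rightarrow> nat option topology" where
  "N_space F = topology (\<lambda>U. None \<in> U \<longrightarrow> Some -` U \<in> F)"

lemma proper_filterD:
  assumes "proper_filter F"
  shows "UNIV \<in> F" "\<And>A B. A \<in> F \<Longrightarrow> B \<in> F \<Longrightarrow> A \<inter> B \<in> F"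
    "\<And>A B. A \<in> F \<Longrightarrow> A \<subseteq> B \<Longrightarrow> B \<in> F" "{} \<notin> F"
proof -
  interpret is_filter "\<lambda>P. Collect P \<in> F"
    using assms by (simp add: proper_filter_def)
  show "UNIV \<in> F"
    using True by simp
  show "A \<inter> B \<in> F" if "A \<in> F" "B \<in> F" for A B
    using conj[of "\<lambda>x. x \<in> A" "\<lambda>x. x \<in> B"] that by (simp add: Int_def)
  show "B \<in> F" if "A \<in> F" "A \<subseteq> B" for A B
    using mono[of "\<lambda>x. x \<in> A" "\<lambda>x. x \<in> B"] that by auto
  show "{} \<notin> F"
    using assms by (simp add: proper_filter_def)
qed

lemma openin_N_space:
  assumes "proper_filter F"
  shows "openin (N_space F) U \<longleftrightarrow> (None \<in> U \<longrightarrow> Some -` U \<in> F)"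
proof -
  have "istopology (\<lambda>U. None \<in> U \<longrightarrow> Some -` U \<in> F)"
    unfolding istopology_def
  proof (intro conjI allI impI)
    fix S T :: "nat option set"
    assume "None \<in> S \<longrightarrow> Some -` S \<in> F" "None \<in> T \<longrightarrow> Some -` T \<in> F" "None \<in> S \<inter> T"
    then show "Some -` (S \<inter> T) \<in> F"
      by (simp add: proper_filterD(2)[OF assms])
  next
    fix K :: "nat option set set"
    assume K: "\<forall>S\<in>K. None \<in> S \<longrightarrow> Some -` S \<in> F" and "None \<in> \<Union>K"
    then obtain S where S: "S \<in> K" "Some -` S \<in> F" by auto
    from S(1) have "Some -` S \<subseteq> Some -` \<Union>K" by auto
    with S(2) show "Some -` \<Union>K \<in> F" by (rule proper_filterD(3)[OF assms])
  qed
  then show ?thesis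
    by (simp add: N_space_def)
qed

lemma topspace_N_space:
  assumes "proper_filter F"
  shows "topspace (N_space F) = UNIV"
proof -
  have "openin (N_space F) UNIV"
    by (simp add: openin_N_space assms proper_filterD(1))
  then show ?thesis
    using openin_subset by blast
qed

lemma Tychonoff_N_space:
  assumes "free_filter F"
  shows "completely_regular_space (N_space F)" "Hausdorff_space (N_space F)"
proof -
  have F: "proper_filter F"
    using assms by (simp add: free_filter_def)
  have co: "- {n} \<in> F" for n
  proof -
    obtain A where "A \<in> F" "n \<notin> A"
      using assms by (auto simp: free_filter_def)
    then show ?thesis
      using proper_filterD(3)[OF F, of A "- {n}"] by auto
  qed
  have clopen_sep: "\<exists>C. openin (N_space F) C \<and> openin (N_space F) (- C) \<and> x \<notin> C \<and> S \<subseteq> C"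
    if S: "closedin (N_space F) S" and x: "x \<notin> S" for S x
  proof (cases x)
    case None
    have "openin (N_space F) (- S)"
      using S by (simp add: closedin_def topspace_N_space[OF F] Compl_eq_Diff_UNIV)
    moreover have "openin (N_space F) S"
      using x None by (simp add: openin_N_space[OF F])
    ultimately show ?thesis
      using x by blast
  next
    case (Some n)
    have "Some -` (- {Some n}) = - {n}" by auto
    then have "openin (N_space F) (- {Some n})" "openin (N_space F) (- (- {Some n}))"
      by (auto simp: openin_N_space[OF F] co)
    then show ?thesis
      using x Some by (intro exI[of _ "- {Some n}"]) auto
  qed
  show cr: "completely_regular_space (N_space F)"
    unfolding completely_regular_space_def
  proof (intro allI impI, elim conjE)
    fix S x
    assume "closedin (N_space F) S" "x \<in> topspace (N_space F) - S"
    then obtain C where C: "openin (N_space F) C" "openin (N_space F) (- C)" "x \<notin> C" "S \<subseteq> C"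
      using clopen_sep by blast
    have "continuous_map (N_space F) (top_of_set {0..1}) (indicator C :: _ \<Rightarrow> real)"
      unfolding continuous_map topspace_N_space[OF F]
    proof (intro conjI allI impI)
      show "indicator C ` UNIV \<subseteq> topspace (top_of_set {0..1::real})"
        by (auto simp: indicator_def)
    next
      fix U :: "real set"
      have "{x \<in> UNIV. indicator C x \<in> U} =
          (if 1 \<in> U then C else {}) \<union> (if 0 \<in> U then - C else {})"
        by (auto simp: indicator_def split: if_splits)
      then show "openin (N_space F) {x \<in> UNIV. indicator C x \<in> U}"
        using C by (simp add: openin_Un)
    qed
    then show "\<exists>f::nat option \<Rightarrow> real. continuous_map (N_space F) (top_of_set {0..1}) f \<and>
        f x = 0 \<and> f ` S \<subseteq> {1}"
      using C by (intro exI[of _ "indicator C"]) (auto simp: indicator_def)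
  qed
  have "closedin (N_space F) {x}" for x
  proof (cases x)
    case None
    then show ?thesis
      by (simp add: closedin_def topspace_N_space[OF F] openin_N_space[OF F])
  next
    case (Some n)
    have "Some -` (UNIV - {Some n}) = - {n}" by auto
    then show ?thesis
      using Some by (simp add: closedin_def topspace_N_space[OF F] openin_N_space[OF F] co)
  qed
  then have "t1_space (N_space F)"
    by (simp add: t1_space_closedin_singleton)
  then show "Hausdorff_space (N_space F)"
    by (rule regular_t1_imp_Hausdorff_space[OF completely_regular_imp_regular_space[OF cr]])
qed

lemma free_filter_dual_density_ideal:
  assumes "density_ideal I"
  shows "free_filter (dual_family I)"
proof -
  obtain \<phi> where \<phi>: "density_submeasure \<phi>" "I = Exh \<phi>" and pf: "proper_filter (dual_family I)"
    using assms by (auto simp: density_ideal_def ideal_on_omega_def)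
  have "- {k} \<in> dual_family I" for k
  proof -
    have "\<phi> ({k} - {0..n}) = 0" if "n \<ge> k" for n
    proof -
      have "{k} - {0..n} = {}" using that by auto
      then show ?thesis
        using \<phi>(1) by (simp only: density_submeasure_def submeasure_def)
    qed
    then have "(\<lambda>n. \<phi> ({k} - {0..n})) \<longlonglongrightarrow> 0"
      by (intro tendsto_eventually eventually_sequentiallyI)
    then show ?thesis
      by (simp add: dual_family_def \<phi>(2) Exh_def)
  qed
  then have "\<Inter>(dual_family I) = {}"
    by (metis ComplD InterE equals0I singletonI)
  with pf show ?thesis
    by (simp add: free_filter_def)
qed

section \<open>The bounded Josefson--Nissenzweig property\<close>

definition BJNP :: "'a topology \<Rightarrow> bool" where
  "BJNP X \<longleftrightarrow>
     (\<exists>\<mu> :: nat \<Rightarrow> 'a fs_measure.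
        (\<forall>n. Poly_Mapping.keys (\<mu> n) \<subseteq> topspace X \<and> fs_norm (\<mu> n) = 1) \<and>
        (\<forall>f. continuous_map X euclideanreal f \<and> bounded (f ` topspace X) \<longrightarrow>
             (\<lambda>n. fs_integral (\<mu> n) f) \<longlonglongrightarrow> 0))"

end

theory Submission
  imports Defs
begin

text \<open>
  Since \<open>\<omega> \<notin> Exh \<phi>\<close>, monotonicity of \<open>\<phi> = sup\<^sub>k \<mu>\<^sub>k\<close> gives \<open>\<epsilon> > 0\<close> and indices \<open>k\<^sub>n\<close> such that
  the restriction \<open>w\<^sub>n\<close> of \<open>\<mu>\<^bsub>k\<^sub>n\<^esub>\<close> to \<open>\<omega> - [0,n]\<close> has mass greater than \<open>\<epsilon>\<close>. Let \<open>\<nu>\<^sub>n\<close> be the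
  normalisation of \<open>w\<^sub>n\<close>; then \<open>(\<nu>\<^sub>n - \<delta>\<^sub>p) / 2\<close> witnesses the BJNP: for \<open>A \<in> I\<close> one has
  \<open>\<nu>\<^sub>n(A) \<le> \<phi>(A - [0,n]) / \<epsilon> \<rightarrow> 0\<close>, and a continuous \<open>f\<close> is close to \<open>f(p)\<close> off some \<open>A \<in> I\<close>.
\<close>

lemma fs_integral_superset:
  assumes "finite S" "Poly_Mapping.keys \<mu> \<subseteq> S"
  shows "fs_integral \<mu> f = (\<Sum>x\<in>S. Poly_Mapping.lookup \<mu> x * f x)"
  unfolding fs_integral_def
  using assms by (intro sum.mono_neutral_left) (auto simp: in_keys_iff)

lemma fs_norm_superset:
  assumes "finite S" "Poly_Mapping.keys \<mu> \<subseteq> S"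
  shows "fs_norm \<mu> = (\<Sum>x\<in>S. \<bar>Poly_Mapping.lookup \<mu> x\<bar>)"
  unfolding fs_norm_def
  using assms by (intro sum.mono_neutral_left) (auto simp: in_keys_iff)

text \<open>The witness is half the difference of the normalised \<open>w\<close> on
  \<open>S\<close> and the point mass at \<open>None\<close>. Each half has norm 1/2 and they sit on
  different points, so the norms add to 1. Since the normalised part has mass 1,
  \<open>f None\<close> can be moved inside the sum; the integral then depends only on differences
  of \<open>f\<close> from its value at the limit point.\<close>

lemma ex_normalized_difference:
  fixes w :: "'a \<Rightarrow> real"
  assumes S: "finite S" and w: "\<And>x. x \<in> S \<Longrightarrow> 0 \<le> w x" and pos: "0 < sum w S"
  obtains \<theta> :: "'a option fs_measure"
  where "fs_norm \<theta> = 1"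
    and "\<And>f. fs_integral \<theta> f = (\<Sum>x\<in>S. w x * (f (Some x) - f None)) / (2 * sum w S)"
proof -
  define g where "g = (\<lambda>y. case y of None \<Rightarrow> - 1 / 2
    | Some x \<Rightarrow> if x \<in> S then w x / (2 * sum w S) else 0)"
  define T where "T = insert None (Some ` S)"
  have T: "finite T" using S by (simp add: T_def)
  have sub: "{y. g y \<noteq> 0} \<subseteq> T"
  proof
    fix y assume "y \<in> {y. g y \<noteq> 0}"
    then show "y \<in> T" by (cases y) (auto simp: g_def T_def split: if_splits)
  qed
  define \<theta> where "\<theta> = Abs_poly_mapping g"
  have look: "Poly_Mapping.lookup \<theta> = g"
    unfolding \<theta>_def using finite_subset[OF sub T] by simp
  have keys: "Poly_Mapping.keys \<theta> \<subseteq> T"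
    using sub by (auto simp: in_keys_iff look)
  have sumT: "sum h T = h None + (\<Sum>x\<in>S. h (Some x))" for h :: "'a option \<Rightarrow> real"
    using S by (simp add: T_def sum.reindex)
  show thesis
  proof
    have "(\<Sum>x\<in>S. \<bar>g (Some x)\<bar>) = (\<Sum>x\<in>S. w x / (2 * sum w S))"
      using pos by (intro sum.cong) (auto simp: g_def w)
    also have "\<dots> = 1 / 2"
      using pos by (simp flip: sum_divide_distrib)
    finally show "fs_norm \<theta> = 1"
      by (simp add: fs_norm_superset[OF T keys] look sumT) (simp add: g_def)
    show "fs_integral \<theta> f = (\<Sum>x\<in>S. w x * (f (Some x) - f None)) / (2 * sum w S)" for f
    proof -
      have "(\<Sum>x\<in>S. g (Some x) * f (Some x)) = (\<Sum>x\<in>S. w x * f (Some x)) / (2 * sum w S)"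
        unfolding sum_divide_distrib by (intro sum.cong) (auto simp: g_def)
      then have "fs_integral \<theta> f = - f None / 2 + (\<Sum>x\<in>S. w x * f (Some x)) / (2 * sum w S)"
        by (simp add: fs_integral_superset[OF T keys] look sumT) (simp add: g_def)
      also have "\<dots> = (\<Sum>x\<in>S. w x * (f (Some x) - f None)) / (2 * sum w S)"
        using pos by (simp add: right_diff_distrib sum_subtractf flip: sum_distrib_right)
          (simp add: field_simps)
      finally show ?thesis .
    qed
  qed
qed

lemma submeasure_mono:
  assumes "submeasure \<phi>" "A \<subseteq> B"
  shows "\<phi> A \<le> \<phi> B"
  using assms unfolding submeasure_def by (metis Un_absorb1)

text \<open>The values decrease in \<open>n\<close>, so a single value at most \<open>e\<close>
  bounds all later ones. Failure of convergence to 0 therefore gives a lower bound at every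
  \<open>n\<close>, not just at infinitely many.\<close>

lemma not_in_Exh_bounded_below:
  assumes \<phi>: "submeasure \<phi>" and A: "A \<notin> Exh \<phi>"
  obtains \<epsilon> :: real where "0 < \<epsilon>" "\<And>n. ennreal \<epsilon> < \<phi> (A - {0..n})"
proof -
  have "\<exists>e>0. \<forall>n. ennreal e < \<phi> (A - {0..n})"
  proof (rule ccontr)
    assume neg: "\<not> (\<exists>e>0. \<forall>n. ennreal e < \<phi> (A - {0..n}))"
    have "(\<lambda>n. \<phi> (A - {0..n})) \<longlonglongrightarrow> 0"
    proof (rule order_tendstoI)
      fix c :: ennreal assume "0 < c"
      \<comment> \<open>Here \<open>c\<close> may be infinite, while the negated claim speaks of
        real bounds; an intermediate \<open>r\<close> is finite and also makes the final inequality
        strict.\<close>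
      then obtain r where r: "0 < r" "r < c" using dense by blast
      then obtain e where e: "r = ennreal e" "0 < e"
        by (cases r) (auto simp: top_unique)
      from neg e(2) obtain N where N: "\<phi> (A - {0..N}) \<le> r"
        unfolding e(1) by (meson not_less)
      have "\<phi> (A - {0..n}) < c" if "n \<ge> N" for n
      proof -
        have "A - {0..n} \<subseteq> A - {0..N}" using that by auto
        from submeasure_mono[OF \<phi> this] N r(2) show ?thesis by order
      qed
      then show "\<forall>\<^sub>F n in sequentially. \<phi> (A - {0..n}) < c"
        by (rule eventually_sequentiallyI)
    qed auto
    with A show False by (simp add: Exh_def)
  qed
  with that show thesis by blast
qed

theorem corollary6p3:
  fixes I :: "nat set set"
  assumes "density_ideal I"
  shows "BJNP (N_space (dual_family I))"
proof -
  obtain \<phi> where pf: "proper_filter (dual_family I)"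
    and \<phi>: "density_submeasure \<phi>" and I: "I = Exh \<phi>"
    using assms by (auto simp: density_ideal_def ideal_on_omega_def)
  from \<phi> obtain \<mu> :: "nat \<Rightarrow> nat fs_measure" where sub: "submeasure \<phi>"
    and nn: "\<And>n x. 0 \<le> Poly_Mapping.lookup (\<mu> n) x"
    and \<mu>: "\<And>A. \<phi> A = (SUP n. ennreal (fs_measure_of (\<mu> n) A))"
    unfolding density_submeasure_def fs_nonneg_def by blast
  have "UNIV \<notin> Exh \<phi>"
    using proper_filterD(4)[OF pf] by (simp add: dual_family_def I)
  then obtain \<epsilon> where \<epsilon>: "0 < \<epsilon>" "\<And>n. ennreal \<epsilon> < \<phi> (UNIV - {0..n})"
    using not_in_Exh_bounded_below[OF sub] by blast
  have "\<exists>k. \<epsilon> < fs_measure_of (\<mu> k) (UNIV - {0..n})" for n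
    using \<epsilon>(2)[of n] \<epsilon>(1) by (auto simp: \<mu> less_SUP_iff ennreal_less_iff)
  then obtain k where k: "\<And>n. \<epsilon> < fs_measure_of (\<mu> (k n)) (UNIV - {0..n})"
    by metis
  define w where "w n = Poly_Mapping.lookup (\<mu> (k n))" for n
  define S where "S n = Poly_Mapping.keys (\<mu> (k n)) \<inter> (UNIV - {0..n})" for n
  have S: "finite (S n)" for n by (simp add: S_def)
  have w: "0 \<le> w n x" for n x by (simp add: w_def nn)
  have mass: "\<epsilon> < sum (w n) (S n)" for n
    using k[of n] by (simp add: w_def[abs_def] S_def fs_measure_of_def)
  \<comment> \<open>\<open>S n\<close> lies beyond \<open>n\<close>, so removing
    \<open>{0..n}\<close> from \<open>A\<close> loses no mass, and one measure is bounded by the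
    supremum.\<close>
  have mass_le: "ennreal (sum (w n) (S n \<inter> A)) \<le> \<phi> (A - {0..n})" for n A
  proof -
    have "S n \<inter> A = Poly_Mapping.keys (\<mu> (k n)) \<inter> (A - {0..n})"
      by (auto simp: S_def)
    then have "sum (w n) (S n \<inter> A) = fs_measure_of (\<mu> (k n)) (A - {0..n})"
      by (simp add: fs_measure_of_def w_def)
    then show ?thesis unfolding \<mu> by (auto intro: SUP_upper)
  qed
  have "\<exists>\<theta> :: nat option fs_measure. fs_norm \<theta> = 1 \<and>
      (\<forall>f. fs_integral \<theta> f = (\<Sum>x\<in>S n. w n x * (f (Some x) - f None)) / (2 * sum (w n) (S n)))" for n
  proof (rule ex_normalized_difference)
    show "0 < sum (w n) (S n)" using mass[of n] \<epsilon>(1) by linarith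
  qed (use S w in blast)+
  then obtain \<theta> :: "nat \<Rightarrow> nat option fs_measure" where norm: "\<And>n. fs_norm (\<theta> n) = 1"
    and int: "\<And>n f. fs_integral (\<theta> n) f =
      (\<Sum>x\<in>S n. w n x * (f (Some x) - f None)) / (2 * sum (w n) (S n))"
    by metis
  have "(\<lambda>n. fs_integral (\<theta> n) f) \<longlonglongrightarrow> 0"
    if cont: "continuous_map (N_space (dual_family I)) euclideanreal f"
      and bdd: "bounded (f ` topspace (N_space (dual_family I)))" for f
  proof (rule LIMSEQ_I)
    fix d :: real assume d: "0 < d"
    obtain B where B: "0 < B" "\<And>x. \<bar>f x\<bar> \<le> B"
      using bdd unfolding topspace_N_space[OF pf] bounded_pos by auto
    \<comment> \<open>The exceptional set: its complement is the trace on the natural numbers of an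
      open neighbourhood of \<open>None\<close>, so \<open>A\<close> lies in
      \<open>I\<close>.\<close>
    define A where "A = {x. d \<le> \<bar>f (Some x) - f None\<bar>}"
    have "openin (N_space (dual_family I)) {y \<in> topspace (N_space (dual_family I)). f y \<in> ball (f None) d}"
      using cont by (rule openin_continuous_map_preimage) simp
    then have "- A \<in> dual_family I"
      using d by (auto simp: openin_N_space[OF pf] topspace_N_space[OF pf] A_def dist_real_def
          vimage_def Compl_eq not_le abs_minus_commute)
    then have "(\<lambda>n. \<phi> (A - {0..n})) \<longlonglongrightarrow> 0"
      by (simp add: dual_family_def I Exh_def)
    \<comment> \<open>Chosen so that \<open>\<eta> * (2 * B) = \<epsilon> * d\<close>: the
      contribution of \<open>A\<close> then stays below \<open>d\<close> times the total mass, which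
      exceeds \<open>\<epsilon>\<close>.\<close>
    moreover define \<eta> where "\<eta> = d * \<epsilon> / (2 * B)"
    have \<eta>: "0 < \<eta>" using d \<epsilon>(1) B(1) by (simp add: \<eta>_def)
    ultimately have "\<forall>\<^sub>F n in sequentially. \<phi> (A - {0..n}) < ennreal \<eta>"
      by (intro order_tendstoD) auto
    then obtain N where N: "\<And>n. n \<ge> N \<Longrightarrow> \<phi> (A - {0..n}) < ennreal \<eta>"
      by (auto simp: eventually_sequentially)
    have "norm (fs_integral (\<theta> n) f - 0) < d" if "n \<ge> N" for n
    proof -
      have small: "sum (w n) (S n \<inter> A) < \<eta>"
        using le_less_trans[OF mass_le N[OF that]] by (simp add: ennreal_less_iff sum_nonneg w)
      have "\<bar>\<Sum>x\<in>S n. w n x * (f (Some x) - f None)\<bar> \<le> (\<Sum>x\<in>S n. w n x * \<bar>f (Some x) - f None\<bar>)"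
        by (rule order_trans[OF sum_abs]) (simp add: abs_mult w)
      \<comment> \<open>Off \<open>A\<close> the difference is below \<open>d\<close>, on
        \<open>A\<close> at most \<open>2 * B\<close>. Keeping the summand with \<open>d\<close> on
        \<open>A\<close> too makes the first part a multiple of the full mass.\<close>
      also have "\<dots> \<le> (\<Sum>x\<in>S n. w n x * d + (if x \<in> A then w n x * (2 * B) else 0))"
      proof (rule sum_mono)
        fix x
        have "\<bar>f (Some x) - f None\<bar> \<le> 2 * B" using B(2)[of "Some x"] B(2)[of None] by linarith
        then have "w n x * \<bar>f (Some x) - f None\<bar> \<le> w n x * (d + (if x \<in> A then 2 * B else 0))"
          using d by (intro mult_left_mono w) (auto simp: A_def)
        then show "w n x * \<bar>f (Some x) - f None\<bar> \<le> w n x * d + (if x \<in> A then w n x * (2 * B) else 0)"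
          by (auto simp: distrib_left)
      qed
      also have "\<dots> = sum (w n) (S n) * d + sum (w n) (S n \<inter> A) * (2 * B)"
        by (simp add: sum.distrib sum_distrib_right S sum.inter_restrict)
          (intro sum.cong, auto)
      also have "\<dots> < sum (w n) (S n) * d + \<eta> * (2 * B)"
        using small B(1) by simp
      also have "\<dots> = sum (w n) (S n) * d + \<epsilon> * d"
        using B(1) by (simp add: \<eta>_def)
      \<comment> \<open>The two parts cost at most one mass times \<open>d\<close> each, which the
        factor 2 in the denominator of \<open>int\<close> absorbs.\<close>
      also have "\<dots> < d * (2 * sum (w n) (S n))"
        using mass[of n] d by (simp add: algebra_simps)
      finally show ?thesis
        using mass[of n] \<epsilon>(1) by (simp add: int abs_mult pos_divide_less_eq)
    qed
    then show "\<exists>N. \<forall>n\<ge>N. norm (fs_integral (\<theta> n) f - 0) < d" by blast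
  qed
  then show ?thesis
    unfolding BJNP_def using norm by (intro exI[of _ \<theta>]) (simp add: topspace_N_space[OF pf])
qed

end
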